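(* Let $x\in\mathbb{R}$, $k\in\mathbb{Z}_{\ge0}$ and $n\in\mathbb{Z}_{>0}$ with $k\le x<k+\frac1n$. Then the $q$-deformation $[x]_q$ is a formal power series of the form $$[x]_q=[k]_q+q^{k+n}+\sum_{i\ge k+n+1}\kappa_i q^i$$ with integer coefficients $\kappa_i$, where $[k]_q=1+q+\cdots+q^{k-1}$ (and $[0]_q=0$).
   Context: For $a\in\mathbb{Z}$ put $[a]_q=\frac{1-q^a}{1-q}$ and $[a]_{q^{-1}}=\frac{1-q^{-a}}{1-q^{-1}}=q^{1-a}[a]_q$. For $x\in\mathbb{R}$ with regular continued fraction expansion $x=[a_1,a_2,a_3,\dots]=a_1+\cfrac{1}{a_2+\cfrac{1}{a_3+\cdots}}$ ($a_1\in\mathbb{Z}$, $a_i\ge1$ for $i\ge2$; finite iff $x$ is rational), the $q$-deformation of $x$ is $$[x]_q=[a_1]_q+\cfrac{q^{a_1}}{[a_2]_{q^{-1}}+\cfrac{q^{-a_2}}{[a_3]_q+\cfrac{q^{a_3}}{[a_4]_{q^{-1}}+\cfrac{q^{-a_4}}{\ddots}}}}.$$ For rational $x$ this is a rational function of $q$ (independent of the choice of the finite expansion), regarded as a Laurent series in $q$; for irrational $x$ the coefficients of the finite truncations stabilize and $[x]_q$ is their limit as a formal Laurent series.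
   Formalization: As stated the claim fails (x = k, or x = 1/3 with k = 0, n = 1, where [x]_q = q^2 − q^3 + …); the formal theorem keeps all hypotheses but includes the term q^{k+n} only when x ≥ k + 1/(n+1), and otherwise its coefficient is 0. *)

theory Defs
  imports Complex_Main "HOL-Computational_Algebra.Formal_Laurent_Series"
begin

section \<open>Regular continued fractions\<close>

text \<open>
  \<^term>\<open>cf_trunc n x\<close> lists the first \<open>n + 1\<close> partial quotients
  of the regular continued fraction of \<open>x\<close>, or all of them if there are fewer.
\<close>

fun cf_trunc :: "nat \<Rightarrow> real \<Rightarrow> int list" where
  "cf_trunc 0 x = [\<lfloor>x\<rfloor>]"
| "cf_trunc (Suc n) x = \<lfloor>x\<rfloor> # (if x \<in> \<int> then [] else cf_trunc n (1 / frac x))"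

fun cf_value :: "int list \<Rightarrow> real" where
  "cf_value [] = 0"
| "cf_value [a] = of_int a"
| "cf_value (a # b # bs) = of_int a + 1 / cf_value (b # bs)"


section \<open>The \<open>q\<close>-deformation\<close>

definition q_int :: "'a::field \<Rightarrow> int \<Rightarrow> 'a" where
  "q_int q a = (1 - q powi a) / (1 - q)"

text \<open>
  The deformed continued fraction alternates between \<open>q\<close> and its inverse; since
  \<open>inverse (inverse q) = q\<close>, this is obtained by inverting the parameter at each level.
\<close>

fun q_cf :: "'a::field \<Rightarrow> int list \<Rightarrow> 'a" where
  "q_cf q [] = 0"
| "q_cf q [a] = q_int q a"
| "q_cf q (a # b # bs) = q_int q a + q powi a / q_cf (inverse q) (b # bs)"

text \<open>
  The limit is taken in the \<open>X\<close>-adic metric of formal Laurent series, that is, coefficients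
  stabilize. For rational \<open>x\<close> the sequence is eventually constant, and evaluating the
  finite continued fraction in the field of Laurent series amounts to expanding the rational
  function at \<open>q = 0\<close>.
\<close>

definition q_real :: "real \<Rightarrow> rat fls" where
  "q_real x = lim (\<lambda>n. q_cf fls_X (cf_trunc n x))"


section \<open>Adequacy of the definitions\<close>

lemma cf_trunc_not_Nil [simp]: "cf_trunc n x \<noteq> []"
  by (cases n) auto

lemma cf_value_Cons: "bs \<noteq> [] \<Longrightarrow> cf_value (a # bs) = of_int a + 1 / cf_value bs"
  by (cases bs) auto

lemma inverse_frac_gt_1: "x \<notin> \<int> \<Longrightarrow> 1 < 1 / frac (x::real)"
  using frac_lt_1[of x] frac_gt_0_iff[of x] by (simp add: field_simps)

lemma cf_trunc_pos:
  assumes "1 \<le> x" "a \<in> set (cf_trunc n x)"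
  shows "1 \<le> a"
  using assms
proof (induction n arbitrary: x)
  case 0
  then show ?case by (simp add: le_floor_iff)
next
  case (Suc n)
  show ?case
  proof (cases "a = \<lfloor>x\<rfloor>")
    case True
    then show ?thesis using Suc.prems by (simp add: le_floor_iff)
  next
    case False
    then have "x \<notin> \<int>" "a \<in> set (cf_trunc n (1 / frac x))"
      using Suc.prems by (auto split: if_splits)
    then show ?thesis using Suc.IH[of "1 / frac x"] inverse_frac_gt_1[of x] by simp
  qed
qed

lemma cf_trunc_tl_pos: "a \<in> set (tl (cf_trunc n x)) \<Longrightarrow> 1 \<le> a"
proof (cases n)
  case (Suc m)
  assume "a \<in> set (tl (cf_trunc n x))"
  with Suc have "x \<notin> \<int>" "a \<in> set (cf_trunc m (1 / frac x))"
    by (auto split: if_splits)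
  then show ?thesis using cf_trunc_pos[of "1 / frac x" a m] inverse_frac_gt_1[of x] by simp
qed simp

lemma cf_value_Suc:
  "x \<notin> \<int> \<Longrightarrow> cf_value (cf_trunc (Suc n) x) = of_int \<lfloor>x\<rfloor> + 1 / cf_value (cf_trunc n (1 / frac x))"
  by (simp add: cf_value_Cons)

lemma cf_value_ge_1: "1 \<le> x \<Longrightarrow> 1 \<le> cf_value (cf_trunc n x)"
proof (induction n arbitrary: x)
  case 0
  then show ?case by (simp add: le_floor_iff)
next
  case (Suc n)
  have f: "1 \<le> real_of_int \<lfloor>x\<rfloor>" using Suc.prems by (simp add: le_floor_iff)
  show ?case
  proof (cases "x \<in> \<int>")
    case True
    then show ?thesis using f by simp
  next
    case False
    have "1 \<le> cf_value (cf_trunc n (1 / frac x))"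
      using Suc.IH inverse_frac_gt_1[OF False] by simp
    then have "0 \<le> 1 / cf_value (cf_trunc n (1 / frac x))" by simp
    then show ?thesis using f cf_value_Suc[OF False, of n] by linarith
  qed
qed

lemma cf_value_error: "\<bar>cf_value (cf_trunc n x) - x\<bar> \<le> 2 * (1/2) ^ n"
proof (induction n arbitrary: x rule: less_induct)
  case (less n)
  have step: "cf_value (cf_trunc (Suc m) z) - z = (w - v) / (v * w)"
    if "z \<notin> \<int>" "w = 1 / frac z" "v = cf_value (cf_trunc m w)" for m z w v
  proof -
    have w: "1 < w" using inverse_frac_gt_1 that by simp
    then have v: "1 \<le> v" using cf_value_ge_1 that by simp
    have "z = of_int \<lfloor>z\<rfloor> + 1 / w" using that by (simp add: frac_def)
    moreover have "cf_value (cf_trunc (Suc m) z) = of_int \<lfloor>z\<rfloor> + 1 / v"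
      using cf_value_Suc that by simp
    ultimately have "cf_value (cf_trunc (Suc m) z) - z = 1 / v - 1 / w" by linarith
    then show ?thesis using v w by (simp add: field_simps)
  qed
  have int: ?case if "x \<in> \<int>"
    using that by (cases n) (auto elim!: Ints_cases)
  consider "n = 0" | "x \<in> \<int>" | "n = 1" "x \<notin> \<int>" | m where "n = Suc (Suc m)" "x \<notin> \<int>"
    by (metis One_nat_def not0_implies_Suc)
  then show ?case
  proof cases
    case 1
    have "\<bar>real_of_int \<lfloor>x\<rfloor> - x\<bar> \<le> 2" by linarith
    with 1 show ?thesis by simp
  next
    case 2
    then show ?thesis by (rule int)
  next
    case 3
    define w where "w = 1 / frac x"
    define v where "v = cf_value (cf_trunc 0 w)"
    have w: "1 < w" using inverse_frac_gt_1 3 w_def by simp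
    have v: "1 \<le> v" using cf_value_ge_1 w v_def less_imp_le by blast
    have vw: "1 \<le> v * w" using v w mult_mono[of 1 v 1 w] by simp
    have "\<bar>w - v\<bar> \<le> 1" unfolding v_def by simp linarith
    then have "\<bar>w - v\<bar> / (v * w) \<le> 1" using vw by (simp add: field_simps)
    then show ?thesis
      using step[OF 3(2) w_def v_def] 3(1) v w by (simp add: abs_mult abs_divide)
  next
    case 4
    define w where "w = 1 / frac x"
    define v where "v = cf_value (cf_trunc (Suc m) w)"
    have w: "1 < w" using inverse_frac_gt_1 4 w_def by simp
    have v: "1 \<le> v" using cf_value_ge_1 w v_def less_imp_le by blast
    have vw: "1 \<le> v * w" using v w mult_mono[of 1 v 1 w] by simp
    have eq: "\<bar>cf_value (cf_trunc n x) - x\<bar> = \<bar>w - v\<bar> / (v * w)"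
      using step[OF 4(2) w_def v_def] 4(1) v w by (simp add: abs_mult abs_divide)
    show ?thesis
    proof (cases "w \<in> \<int>")
      case True
      then have "v = w" unfolding v_def by (auto elim!: Ints_cases)
      then show ?thesis using eq by simp
    next
      case False
      define w' where "w' = 1 / frac w"
      define v' where "v' = cf_value (cf_trunc m w')"
      have w': "1 < w'" using inverse_frac_gt_1 False w'_def by simp
      have v': "1 \<le> v'" using cf_value_ge_1 w' v'_def less_imp_le by blast
      have a: "1 \<le> real_of_int \<lfloor>w\<rfloor>" using w by (simp add: le_floor_iff)
      have W: "w = of_int \<lfloor>w\<rfloor> + 1 / w'" using w'_def by (simp add: frac_def)
      have V: "v = of_int \<lfloor>w\<rfloor> + 1 / v'"
        using cf_value_Suc[OF False, of m] unfolding v_def v'_def w'_def by simp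
      have "w * w' = of_int \<lfloor>w\<rfloor> * w' + 1"
        using w' by (subst W) (simp add: field_simps)
      moreover have "1 * 1 \<le> of_int \<lfloor>w\<rfloor> * w'" using a w' by (intro mult_mono) auto
      ultimately have ww: "2 \<le> w * w'" by linarith
      have "v * v' = of_int \<lfloor>w\<rfloor> * v' + 1"
        using v' by (subst V) (simp add: field_simps)
      moreover have "1 * 1 \<le> of_int \<lfloor>w\<rfloor> * v'" using a v' by (intro mult_mono) auto
      ultimately have vv: "2 \<le> v * v'" by linarith
      have four: "4 \<le> (v * v') * (w * w')" using mult_mono[OF vv ww] vv by simp
      have "\<bar>w - v\<bar> = \<bar>w' - v'\<bar> / (v' * w')"
        using step[OF False w'_def v'_def] v' w' unfolding v_def[symmetric]
        by (metis abs_divide abs_minus_commute abs_of_pos less_le_trans mult_pos_pos zero_less_one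
            less_trans)
      then have "\<bar>cf_value (cf_trunc n x) - x\<bar> = \<bar>w' - v'\<bar> / ((v * v') * (w * w'))"
        using eq by (simp add: mult_ac)
      also have "\<dots> \<le> \<bar>w' - v'\<bar> / 4"
        using four by (intro divide_left_mono) auto
      also have "\<dots> \<le> 2 * (1/2) ^ m / 4"
        using less.IH[of m w'] 4(1) unfolding v'_def by (simp add: abs_minus_commute)
      finally show ?thesis using 4(1) by simp
    qed
  qed
qed

lemma cf_value_tendsto: "(\<lambda>n. cf_value (cf_trunc n x)) \<longlonglongrightarrow> x"
proof -
  have "(\<lambda>n. 2 * (1/2) ^ n :: real) \<longlonglongrightarrow> 2 * 0"
    by (intro tendsto_mult tendsto_const LIMSEQ_power_zero) auto
  then have g: "(\<lambda>n. 2 * (1/2) ^ n :: real) \<longlonglongrightarrow> 0" by simp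
  have "(\<lambda>n. \<bar>cf_value (cf_trunc n x) - x\<bar>) \<longlonglongrightarrow> 0"
    by (rule tendsto_sandwich[OF _ _ tendsto_const g])
      (rule always_eventually, rule allI, rule abs_ge_zero cf_value_error)+
  from LIM_zero_cancel[OF tendsto_rabs_zero_cancel[OF this]] show ?thesis .
qed

lemma cf_trunc_rational:
  assumes "x \<in> \<rat>"
  shows "\<exists>N. cf_value (cf_trunc N x) = x \<and> (\<forall>n\<ge>N. cf_trunc n x = cf_trunc N x)"
proof -
  have "\<exists>N. cf_value (cf_trunc N x) = x \<and> (\<forall>n\<ge>N. cf_trunc n x = cf_trunc N x)"
    if "x = of_int p / of_nat d" "0 < d" for x :: real and p :: int and d :: nat
    using that
  proof (induction d arbitrary: x p rule: less_induct)
    case (less d)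
    show ?case
    proof (cases "x \<in> \<int>")
      case True
      then have "cf_trunc n x = [\<lfloor>x\<rfloor>]" for n by (cases n) auto
      then show ?thesis using True by (auto elim!: Ints_cases)
    next
      case False
      define r where "r = p - \<lfloor>x\<rfloor> * int d"
      have fr: "frac x = of_int r / of_nat d"
        using less.prems by (simp add: frac_def r_def field_simps)
      have "0 < frac x" "frac x < 1" using False frac_lt_1 frac_gt_0_iff by auto
      then have r: "0 < r" "r < int d"
        using less.prems(2) unfolding fr by (auto simp: field_simps)
      have y: "1 / frac x = of_int (int d) / of_nat (nat r)" using r fr by simp
      obtain N where N: "cf_value (cf_trunc N (1 / frac x)) = 1 / frac x"
        "\<And>n. n \<ge> N \<Longrightarrow> cf_trunc n (1 / frac x) = cf_trunc N (1 / frac x)"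
        using less.IH[OF _ y] r by (metis zero_less_nat_eq nat_less_iff less_imp_le)
      have "cf_value (cf_trunc (Suc N) x) = x"
        using cf_value_Suc[OF False, of N] N(1) by (simp add: frac_def)
      moreover have "cf_trunc n x = cf_trunc (Suc N) x" if "n \<ge> Suc N" for n
      proof -
        obtain m where m: "n = Suc m" "m \<ge> N" using \<open>n \<ge> Suc N\<close> by (cases n) auto
        show ?thesis unfolding m(1) cf_trunc.simps N(2)[OF m(2)] ..
      qed
      ultimately show ?thesis by blast
    qed
  qed
  moreover obtain p d where "x = of_int p / of_int d" "d > 0"
    using assms by (auto elim!: Rats_cases')
  then have "x = of_int p / of_nat (nat d)" "0 < nat d" by auto
  ultimately show ?thesis by blast
qed

lemma q_real_rational:
  assumes "x \<in> \<rat>"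
  obtains N where "cf_value (cf_trunc N x) = x" "q_real x = q_cf fls_X (cf_trunc N x)"
proof -
  obtain N where N: "cf_value (cf_trunc N x) = x" "\<forall>n\<ge>N. cf_trunc n x = cf_trunc N x"
    using cf_trunc_rational[OF assms] by blast
  have "(\<lambda>n. q_cf fls_X (cf_trunc n x) :: rat fls) \<longlonglongrightarrow> q_cf fls_X (cf_trunc N x)"
    using N(2) by (intro tendsto_eventually) (metis (mono_tags, lifting) eventually_sequentially)
  then have "q_real x = q_cf fls_X (cf_trunc N x)" unfolding q_real_def by (rule limI)
  with N(1) show ?thesis by (rule that)
qed

text \<open>
  By the next two facts the coefficient of \<open>q ^ (k + n)\<close> in the deformation of
  \<open>x \<in> {k..<k + 1 / n}\<close> need not be \<open>1\<close>: it is \<open>0\<close> for \<open>x = k\<close>, and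
  for \<open>k = 0\<close>, \<open>n = 1\<close>, \<open>x = 1 / 3\<close>.
\<close>

lemma q_real_of_int: "q_real (of_int k) = q_int fls_X k"
proof -
  have "cf_trunc n (of_int k) = [k]" for n by (cases n) auto
  then show ?thesis by (simp add: q_real_def)
qed

lemma q_real_one_third: "q_real (1 / 3) = fls_X ^ 2 / (1 + fls_X + fls_X ^ 2)"
proof -
  have fr: "frac (1 / 3 :: real) = 1 / 3" by (simp add: frac_eq)
  have ni: "(1 / 3 :: real) \<notin> \<int>"
    using fr frac_eq_0_iff[of "1 / 3 :: real"] by simp
  have three: "cf_trunc n 3 = [3]" for n by (cases n) auto
  have "cf_trunc (Suc n) (1 / 3) = [0, 3]" for n
    using ni fr three by simp
  then have "\<forall>n\<ge>1. cf_trunc n (1 / 3) = [0, 3]" by (metis One_nat_def Suc_le_D)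
  then have "(\<lambda>n. q_cf fls_X (cf_trunc n (1 / 3)) :: rat fls) \<longlonglongrightarrow> q_cf fls_X [0, 3]"
    by (intro tendsto_eventually) (auto simp: eventually_sequentially intro!: exI[of _ 1])
  then have "q_real (1 / 3) = q_cf fls_X [0, 3]" unfolding q_real_def by (rule limI)
  also have "\<dots> = fls_X ^ 2 / (1 + fls_X + fls_X ^ 2)"
  proof -
    have X: "(fls_X :: rat fls) \<noteq> 0" "(fls_X :: rat fls) \<noteq> 1"
      by (auto simp: fls_eq_iff intro: exI[of _ 1])
    have "q_cf q [0, 3] = q ^ 2 / (1 + q + q ^ 2)" if "q \<noteq> 0" "q \<noteq> 1" for q :: "rat fls"
    proof -
      have "inverse q \<noteq> 1" using that by (metis inverse_1 inverse_inverse_eq)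
      have "1 - inverse q ^ 3 = (1 + inverse q + inverse q ^ 2) * (1 - inverse q)"
        by (simp add: algebra_simps power2_eq_square power3_eq_cube)
      then have "(1 - inverse q ^ 3) / (1 - inverse q) = 1 + inverse q + inverse q ^ 2"
        using \<open>inverse q \<noteq> 1\<close> by simp
      also have "\<dots> = (1 + q + q ^ 2) / q ^ 2"
        using that by (simp add: field_simps power2_eq_square)
      finally have e: "(1 - inverse q ^ 3) / (1 - inverse q) = (1 + q + q ^ 2) / q ^ 2" .
      have "q_cf q [0, 3] = 1 / ((1 - inverse q ^ 3) / (1 - inverse q))"
        by (simp add: q_int_def power_int_def)
      then show ?thesis unfolding e by simp
    qed
    then show ?thesis using X by blast
  qed
  finally show ?thesis .
qed

end

theory Submission
  imports Defs
begin

text \<open>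
  Two consecutive levels of the deformed continued fraction combine into the map
  \[ g \mapsto [a]_q + \frac{q^a}{[b]_{q^{-1}} + q^{-b} / g}
       = [a]_q + q^{a+b} \frac{g}{1 + q [b]_q g}, \]
  which is free of negative powers of \<open>q\<close>. On power series with constant term 1 it preserves
  integrality, and it multiplies differences by \<open>q ^ (a + b)\<close> times a unit. Hence truncations
  converge to an integral power series, whose leading terms are visible after a single application
  of the map: with \<open>a = k\<close>, the first correction to \<open>[k]\<^sub>q\<close> is \<open>q ^ (k + b)\<close>, or
  \<open>q ^ (k + b - 1)\<close> if the continued fraction stops at \<open>b\<close>.
\<close>

section \<open>Integral power series\<close>

definition fps_int_coeffs :: "'a::ring_1 fps \<Rightarrow> bool" where
  "fps_int_coeffs f \<longleftrightarrow> (\<forall>i. f $ i \<in> \<int>)"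

lemma fps_int_coeffs_add: "fps_int_coeffs f \<Longrightarrow> fps_int_coeffs g \<Longrightarrow> fps_int_coeffs (f + g)"
  by (simp add: fps_int_coeffs_def)

lemma fps_int_coeffs_mult: "fps_int_coeffs f \<Longrightarrow> fps_int_coeffs g \<Longrightarrow> fps_int_coeffs (f * g)"
  by (auto simp: fps_int_coeffs_def fps_mult_nth intro!: Ints_sum)

lemma fps_int_coeffs_1: "fps_int_coeffs 1"
  by (simp add: fps_int_coeffs_def)

lemma fps_int_coeffs_X_power: "fps_int_coeffs (fps_X ^ n)"
  by (simp add: fps_int_coeffs_def)

lemma fps_int_coeffs_X: "fps_int_coeffs fps_X"
  using fps_int_coeffs_X_power[of 1] by simp

text \<open>Since the constant term is 1, comparing coefficients in \<open>f * inverse f = 1\<close>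
  expresses each coefficient of the inverse through earlier ones without any division.\<close>

lemma fps_int_coeffs_inverse:
  fixes f :: "'a::field fps"
  assumes "fps_int_coeffs f" "f $ 0 = 1"
  shows "fps_int_coeffs (inverse f)"
  unfolding fps_int_coeffs_def
proof
  fix i
  show "inverse f $ i \<in> \<int>"
  proof (induction i rule: less_induct)
    case (less i)
    show ?case
    proof (cases "i = 0")
      case True
      then show ?thesis using assms(2) by simp
    next
      case False
      have "0 = (f * inverse f) $ i"
        using inverse_mult_eq_1'[of f] assms(2) False by simp
      also have "\<dots> = inverse f $ i + (\<Sum>j=1..i. f $ j * inverse f $ (i - j))"
        using assms(2) by (simp add: fps_mult_nth sum.atLeast_Suc_atMost)
      finally have "inverse f $ i = - (\<Sum>j=1..i. f $ j * inverse f $ (i - j))"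
        by (simp add: eq_neg_iff_add_eq_0)
      also have "\<dots> \<in> \<int>"
        using assms(1) less by (intro Ints_minus Ints_sum Ints_mult) (auto simp: fps_int_coeffs_def)
      finally show ?thesis .
    qed
  qed
qed

lemma fps_X_power_dvd_iff_nth:
  fixes f :: "'a::field fps"
  shows "fps_X ^ n dvd f \<longleftrightarrow> (\<forall>i<n. f $ i = 0)"
proof
  assume "fps_X ^ n dvd f"
  then show "\<forall>i<n. f $ i = 0"
    by (auto elim!: dvdE simp: fps_X_power_mult_nth)
next
  assume "\<forall>i<n. f $ i = 0"
  then have "f = fps_X ^ n * Abs_fps (\<lambda>i. f $ (i + n))"
    by (auto simp: fps_eq_iff fps_X_power_mult_nth)
  then show "fps_X ^ n dvd f" by (metis dvd_triv_left)
qed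

text \<open>The embedding is an isometry for the two X-adic metrics.\<close>

lemma tendsto_fps_to_fls:
  fixes f :: "'b \<Rightarrow> 'a::ab_group_add fps"
  assumes "(f \<longlongrightarrow> l) F"
  shows "((\<lambda>x. fps_to_fls (f x)) \<longlongrightarrow> fps_to_fls l) F"
proof -
  have "dist (fps_to_fls a) (fps_to_fls b) = dist a b" for a b :: "'a fps"
    by (simp add: dist_fls_def dist_fps_def fls_subdegree_fls_to_fps flip: fps_to_fls_minus)
  with assms show ?thesis by (simp add: tendsto_dist_iff[of _ l] tendsto_dist_iff[of _ "fps_to_fls l"])
qed

section \<open>Deformed continued fractions as power series\<close>

definition fps_q_nat :: "nat \<Rightarrow> 'a::field fps" where
  "fps_q_nat n = (\<Sum>i<n. fps_X ^ i)"

lemma fps_q_nat_nth: "fps_q_nat n $ i = (if i < n then 1 else 0)"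
  by (simp add: fps_q_nat_def fps_sum_nth)

lemma fps_int_coeffs_q_nat: "fps_int_coeffs (fps_q_nat n)"
  by (simp add: fps_int_coeffs_def fps_q_nat_nth)

lemma q_int_of_nat: "q \<noteq> 1 \<Longrightarrow> q_int q (int n) = (\<Sum>i<n. q ^ i)"
  by (simp add: q_int_def sum_gp_strict)

lemma fls_X_neq_0_1: "(fls_X :: 'a::field fls) \<noteq> 0" "(fls_X :: 'a::field fls) \<noteq> 1"
  by (auto simp: fls_eq_iff intro: exI[of _ 1])

lemma fps_to_fls_sum: "fps_to_fls (\<Sum>i\<in>A. f i) = (\<Sum>i\<in>A. fps_to_fls (f i))"
  by (induction A rule: infinite_finite_induct) auto

lemma q_int_fls_X: "q_int fls_X (int n) = fps_to_fls (fps_q_nat n)"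
  by (simp add: fls_X_neq_0_1 q_int_of_nat fps_q_nat_def fps_to_fls_sum fps_to_fls_power)

lemma q_int_inverse:
  assumes "q \<noteq> 0" "q \<noteq> 1"
  shows "q_int (inverse q) (int n) = q * q_int q (int n) / q ^ n"
proof -
  have "1 - q \<noteq> 0" "q - 1 \<noteq> 0" using assms by auto
  with assms show ?thesis
    by (simp add: q_int_def field_simps)
qed

section \<open>Merging two levels into one operation on power series\<close>

text \<open>The parameter is inverted twice, so the tail is again \<open>q_cf q bs\<close>. By
  \<open>q_int_inverse\<close>, both terms of the second level carry the factor
  \<open>1 / q ^ b\<close>, which moves up to give \<open>q ^ (a + b)\<close>.\<close>

lemma q_cf_two_levels:
  assumes "q \<noteq> 0" "q \<noteq> 1"
  shows "q_cf q [int a, int b] = q_int q (int a) + q ^ (a + b) / (q * q_int q (int b))"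
    and "bs \<noteq> [] \<Longrightarrow> q_cf q bs \<noteq> 0 \<Longrightarrow> q_cf q (int a # int b # bs)
      = q_int q (int a) + q ^ (a + b) * (q_cf q bs / (1 + q * q_int q (int b) * q_cf q bs))"
proof -
  show "q_cf q [int a, int b] = q_int q (int a) + q ^ (a + b) / (q * q_int q (int b))"
    using q_int_inverse[OF assms, of b] by (simp add: power_add)
  assume bs: "bs \<noteq> []" "q_cf q bs \<noteq> 0"
  have "q * q_int q (int b) / q ^ b + inverse q ^ b / q_cf q bs
      = (1 + q * q_int q (int b) * q_cf q bs) / (q ^ b * q_cf q bs)"
    using assms bs(2) by (simp add: power_inverse field_simps)
  moreover obtain c cs where "bs = c # cs" using bs(1) by (cases bs) auto
  ultimately show "q_cf q (int a # int b # bs)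
      = q_int q (int a) + q ^ (a + b) * (q_cf q bs / (1 + q * q_int q (int b) * q_cf q bs))"
    using q_int_inverse[OF assms, of b] by (simp add: power_add)
qed

text \<open>The case where the expansion ends at \<open>b\<close>, formally
  \<open>fps_cf_step\<close> at infinite \<open>g\<close>. For \<open>0 < b\<close> the factor
  \<open>q\<close> of the denominator cancels into the exponent, and \<open>fps_q_nat b\<close> is a
  unit.\<close>

definition fps_cf_pair :: "nat \<Rightarrow> nat \<Rightarrow> 'a::field fps" where
  "fps_cf_pair a b = fps_q_nat a + fps_X ^ (a + b - 1) * inverse (fps_q_nat b)"

definition fps_cf_step :: "nat \<Rightarrow> nat \<Rightarrow> 'a::field fps \<Rightarrow> 'a fps" where
  "fps_cf_step a b g = fps_q_nat a + fps_X ^ (a + b) * (g * inverse (1 + fps_X * fps_q_nat b * g))"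

lemma fps_to_fls_inverse:
  fixes f :: "'a::field fps"
  assumes "f $ 0 \<noteq> 0"
  shows "fps_to_fls (inverse f) = inverse (fps_to_fls f)"
proof -
  have "fps_to_fls f * fps_to_fls (inverse f) = 1"
    using inverse_mult_eq_1'[OF assms] by (simp flip: fls_times_fps_to_fls)
  then show ?thesis by (metis inverse_unique)
qed

lemma q_cf_pair:
  assumes "0 < b"
  shows "q_cf fls_X [int a, int b] = fps_to_fls (fps_cf_pair a b)"
proof -
  let ?B = "fps_to_fls (fps_q_nat b) :: 'a fls"
  have B: "fps_to_fls (inverse (fps_q_nat b)) = inverse ?B"
    using assms by (intro fps_to_fls_inverse) (simp add: fps_q_nat_nth)
  have cancel: "q ^ (a + b) / (q * c) = q ^ (a + b - 1) * inverse c" if "q \<noteq> 0" for q c :: "'a fls"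
    using that assms by (cases b) (simp_all add: divide_inverse)
  show ?thesis
    unfolding q_cf_two_levels(1)[OF fls_X_neq_0_1] q_int_fls_X cancel[OF fls_X_neq_0_1(1)]
    by (simp add: fps_cf_pair_def fls_times_fps_to_fls fps_to_fls_power B)
qed

lemma q_cf_step:
  assumes "q_cf fls_X bs = fps_to_fls g" "bs \<noteq> []" "g $ 0 = 1"
  shows "q_cf fls_X (int a # int b # bs) = fps_to_fls (fps_cf_step a b g)"
proof -
  have I: "fps_to_fls (inverse (1 + fps_X * fps_q_nat b * g))
      = inverse (1 + fls_X * fps_to_fls (fps_q_nat b) * fps_to_fls g)"
    using fps_to_fls_inverse[of "1 + fps_X * fps_q_nat b * g"]
    by (simp add: fls_times_fps_to_fls)
  have "(q_cf fls_X bs :: 'a fls) \<noteq> 0" using assms(1,3) by auto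
  from q_cf_two_levels(2)[OF fls_X_neq_0_1 assms(2) this, of a b] show ?thesis
    unfolding q_int_fls_X assms(1) fps_cf_step_def
    by (simp only: fls_times_fps_to_fls fps_to_fls_power fps_to_fls_plus fps_X_to_fls I divide_inverse)
qed

lemma fps_int_coeffs_cf_pair: "0 < b \<Longrightarrow> fps_int_coeffs (fps_cf_pair a b)"
  unfolding fps_cf_pair_def
  by (intro fps_int_coeffs_add fps_int_coeffs_mult fps_int_coeffs_inverse fps_int_coeffs_X_power
      fps_int_coeffs_q_nat) (simp add: fps_q_nat_nth)

lemma fps_int_coeffs_cf_step: "fps_int_coeffs g \<Longrightarrow> fps_int_coeffs (fps_cf_step a b g)"
  unfolding fps_cf_step_def
  by (intro fps_int_coeffs_add fps_int_coeffs_mult fps_int_coeffs_inverse fps_int_coeffs_X_power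
      fps_int_coeffs_q_nat fps_int_coeffs_X fps_int_coeffs_1) auto

text \<open>With \<open>c = fps_X * fps_q_nat b\<close>, the difference of
  \<open>g / (1 + c * g)\<close> and \<open>h / (1 + c * h)\<close> is \<open>g - h\<close> over the
  product of the denominators, which are units because \<open>c\<close> has constant term 0.\<close>

lemma fps_cf_step_diff_dvd:
  assumes "fps_X ^ n dvd g - h"
  shows "fps_X ^ (a + b + n) dvd fps_cf_step a b g - fps_cf_step a b h"
proof -
  define D where "D f = 1 + fps_X * fps_q_nat b * f" for f :: "'a fps"
  have i: "inverse (D f) * D f = 1" for f
    by (rule inverse_mult_eq_1) (simp add: D_def)
  have ring: "g * p * (r * (1 + c * h)) - h * r * (p * (1 + c * g)) = (g - h) * (p * r)"
    for p r c :: "'a fps" by (simp add: algebra_simps)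
  have "g * inverse (D g) - h * inverse (D h)
      = g * inverse (D g) * (inverse (D h) * D h) - h * inverse (D h) * (inverse (D g) * D g)"
    by (simp add: i)
  also have "\<dots> = (g - h) * (inverse (D g) * inverse (D h))"
    using ring[of "inverse (D g)" "inverse (D h)" "fps_X * fps_q_nat b"] by (simp only: D_def)
  finally have "fps_cf_step a b g - fps_cf_step a b h
      = fps_X ^ (a + b) * ((g - h) * (inverse (D g) * inverse (D h)))"
    by (simp add: fps_cf_step_def flip: D_def right_diff_distrib)
  with assms show ?thesis by (simp add: power_add[of _ "a + b"] mult_dvd_mono)
qed

section \<open>Truncations as integral power series\<close>

text \<open>Descending two levels at a time keeps the parameter equal to \<open>q\<close>; the two
  base cases account for the parity of the truncation. For \<open>0 \<le> x\<close> no quotient is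
  changed by \<open>nat\<close>.\<close>

fun fps_cf :: "nat \<Rightarrow> real \<Rightarrow> 'a::field fps" where
  "fps_cf 0 x = fps_q_nat (nat \<lfloor>x\<rfloor>)"
| "fps_cf (Suc 0) x = (if x \<in> \<int> then fps_q_nat (nat \<lfloor>x\<rfloor>)
     else fps_cf_pair (nat \<lfloor>x\<rfloor>) (nat \<lfloor>1 / frac x\<rfloor>))"
| "fps_cf (Suc (Suc n)) x = (if x \<in> \<int> then fps_q_nat (nat \<lfloor>x\<rfloor>)
     else if 1 / frac x \<in> \<int> then fps_cf_pair (nat \<lfloor>x\<rfloor>) (nat \<lfloor>1 / frac x\<rfloor>)
     else fps_cf_step (nat \<lfloor>x\<rfloor>) (nat \<lfloor>1 / frac x\<rfloor>) (fps_cf n (1 / frac (1 / frac x))))"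

lemma floor_inverse_frac_pos: "x \<notin> \<int> \<Longrightarrow> 1 \<le> \<lfloor>1 / frac (x::real)\<rfloor>"
  using inverse_frac_gt_1[of x] by linarith

text \<open>The first quotient is at least 1, so its q-integer supplies the constant term and the
  correction has positive order. Tails exceed 1, so this meets the requirement of
  \<open>q_cf_step\<close>.\<close>

lemma fps_cf_nth_0:
  assumes "1 \<le> x"
  shows "fps_cf n x $ 0 = 1"
proof -
  have pair: "fps_cf_pair a b $ 0 = (1 :: 'a)" if "0 < a" "0 < b" for a b
    using that by (simp add: fps_cf_pair_def fps_q_nat_nth fps_X_power_mult_nth)
  have step: "fps_cf_step a b g $ 0 = (1 :: 'a)" if "0 < a" for a b g
    using that by (simp add: fps_cf_step_def fps_q_nat_nth fps_X_power_mult_nth)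
  have "0 < nat \<lfloor>x\<rfloor>" using assms by linarith
  moreover have "x \<notin> \<int> \<Longrightarrow> 0 < nat \<lfloor>1 / frac x\<rfloor>" using floor_inverse_frac_pos[of x] by linarith
  ultimately show ?thesis
    by (cases "(n, x)" rule: fps_cf.cases) (use assms in \<open>auto simp: fps_q_nat_nth pair step\<close>)
qed

lemma fps_int_coeffs_fps_cf: "fps_int_coeffs (fps_cf n x)"
proof (induction n x rule: fps_cf.induct)
  case (1 x)
  show ?case by (simp add: fps_int_coeffs_q_nat)
next
  case (2 x)
  then show ?case using floor_inverse_frac_pos[of x]
    by (simp add: fps_int_coeffs_q_nat fps_int_coeffs_cf_pair)
next
  case (3 n x)
  then show ?case using floor_inverse_frac_pos[of x]
    by (simp add: fps_int_coeffs_q_nat fps_int_coeffs_cf_pair fps_int_coeffs_cf_step)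
qed

lemma q_cf_trunc_eq_fps_cf: "0 \<le> x \<Longrightarrow> q_cf fls_X (cf_trunc n x) = fps_to_fls (fps_cf n x)"
proof (induction n x rule: fps_cf.induct)
  case (1 x)
  then have "int (nat \<lfloor>x\<rfloor>) = \<lfloor>x\<rfloor>" by simp
  then show ?case using q_int_fls_X[of "nat \<lfloor>x\<rfloor>", where 'a = 'a] by simp
next
  case (2 x)
  then have a: "int (nat \<lfloor>x\<rfloor>) = \<lfloor>x\<rfloor>" by simp
  show ?case
    using q_int_fls_X[of "nat \<lfloor>x\<rfloor>", where 'a = 'a] a floor_inverse_frac_pos[of x]
      q_cf_pair[of "nat \<lfloor>1 / frac x\<rfloor>" "nat \<lfloor>x\<rfloor>", where 'a = 'a]
    by simp
next
  case (3 n x)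
  have a: "int (nat \<lfloor>x\<rfloor>) = \<lfloor>x\<rfloor>" using "3.prems" by simp
  define y where "y = 1 / frac x"
  consider "x \<in> \<int>" | "x \<notin> \<int>" "y \<in> \<int>" | "x \<notin> \<int>" "y \<notin> \<int>" by blast
  then show ?case
  proof cases
    case 1
    then show ?thesis using q_int_fls_X[of "nat \<lfloor>x\<rfloor>", where 'a = 'a] a by simp
  next
    case 2
    then show ?thesis
      using a floor_inverse_frac_pos[of x] q_cf_pair[of "nat \<lfloor>y\<rfloor>" "nat \<lfloor>x\<rfloor>", where 'a = 'a]
      by (simp flip: y_def)
  next
    case ni: 3
    have z: "1 \<le> 1 / frac y" using inverse_frac_gt_1[OF ni(2)] by simp
    have b: "int (nat \<lfloor>y\<rfloor>) = \<lfloor>y\<rfloor>" using floor_inverse_frac_pos[OF ni(1)] by (simp add: y_def)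
    have "q_cf fls_X (cf_trunc n (1 / frac y)) = (fps_to_fls (fps_cf n (1 / frac y)) :: 'a fls)"
      using "3.IH" ni z by (simp add: y_def)
    from q_cf_step[OF this _ fps_cf_nth_0[OF z], of "nat \<lfloor>x\<rfloor>" "nat \<lfloor>y\<rfloor>"] show ?thesis
      using ni a b by (simp flip: y_def)
  qed
qed

section \<open>X-adic convergence of the truncations\<close>

text \<open>Each descent by two levels gains \<open>a + b \<ge> 2\<close> powers of
  \<open>fps_X\<close>, which matches the drop of the index by two.\<close>

lemma fps_cf_stable:
  assumes "1 \<le> x" "n \<le> m"
  shows "fps_X ^ n dvd fps_cf m x - (fps_cf n x :: 'a::field fps)"
  using assms
proof (induction n x arbitrary: m rule: fps_cf.induct)
  case (1 x)
  show ?case by simp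
next
  case (2 x)
  \<comment> \<open>Modulo \<open>fps_X\<close> only constant terms count, and both are 1.\<close>
  then show ?case unfolding fps_X_power_dvd_iff_nth by (simp add: fps_cf_nth_0 del: fps_cf.simps)
next
  case (3 n x)
  obtain m' where m: "m = Suc (Suc m')" "n \<le> m'"
    using "3.prems" by (metis Suc_le_D Suc_le_mono)
  define y where "y = 1 / frac x"
  show ?case
  proof (cases "x \<in> \<int> \<or> y \<in> \<int>")
    case True
    then show ?thesis by (auto simp: m y_def)
  next
    case ni: False
    have "1 \<le> 1 / frac y" using inverse_frac_gt_1[of y] ni by simp
    then have "fps_X ^ n dvd fps_cf m' (1 / frac y) - (fps_cf n (1 / frac y) :: 'a fps)"
      using "3.IH" ni m(2) by (simp add: y_def)
    from fps_cf_step_diff_dvd[OF this, of "nat \<lfloor>x\<rfloor>" "nat \<lfloor>y\<rfloor>"]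
    have "fps_X ^ (nat \<lfloor>x\<rfloor> + nat \<lfloor>y\<rfloor> + n) dvd fps_cf m x - (fps_cf (Suc (Suc n)) x :: 'a fps)"
      using ni by (simp add: m flip: y_def)
    moreover have "1 \<le> nat \<lfloor>x\<rfloor>" "1 \<le> nat \<lfloor>y\<rfloor>"
      using "3.prems"(1) floor_inverse_frac_pos[of x] ni by (simp_all add: y_def le_nat_iff le_floor_iff)
    then have "Suc (Suc n) \<le> nat \<lfloor>x\<rfloor> + nat \<lfloor>y\<rfloor> + n" by linarith
    ultimately show ?thesis by (rule power_le_dvd)
  qed
qed

text \<open>For \<open>x < 1\<close> the previous lemma does not apply to \<open>x\<close>, but it
  applies to the tail after two quotients, which exceeds 1.\<close>

lemma fps_cf_Suc_Suc_stable:
  assumes "n \<le> m"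
  shows "fps_X ^ n dvd fps_cf (Suc (Suc m)) x - (fps_cf (Suc (Suc n)) x :: 'a::field fps)"
proof (cases "x \<in> \<int> \<or> 1 / frac x \<in> \<int>")
  case False
  have "1 \<le> 1 / frac (1 / frac x)" using inverse_frac_gt_1[of "1 / frac x"] False by simp
  from fps_cf_step_diff_dvd[OF fps_cf_stable[OF this assms], of "nat \<lfloor>x\<rfloor>" "nat \<lfloor>1 / frac x\<rfloor>"]
  show ?thesis using False by (auto intro: power_le_dvd)
qed auto

text \<open>The limit inherits every property of the form ``the \<open>i\<close>-th coefficient lies in \<open>S\<^sub>i\<close>''.\<close>

lemma q_real_eq_fps:
  assumes "0 \<le> x"
  obtains f where "q_real x = fps_to_fls f" "\<And>i. \<exists>n. f $ i = fps_cf (Suc (Suc n)) x $ i"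
proof -
  \<comment> \<open>Agreement modulo \<open>fps_X ^ Suc i\<close> is needed to fix coefficient
    \<open>i\<close>, hence the third \<open>Suc\<close>.\<close>
  define f :: "rat fps" where "f = Abs_fps (\<lambda>i. fps_cf (Suc (Suc (Suc i))) x $ i)"
  have "fps_cf (Suc (Suc m)) x $ i = f $ i" if "Suc i \<le> m" for i m
    using fps_cf_Suc_Suc_stable[OF that, of x, where 'a = rat]
    unfolding fps_X_power_dvd_iff_nth by (simp add: f_def del: fps_cf.simps)
  then have "fps_cf m x $ i = f $ i" if "Suc (Suc (Suc i)) \<le> m" for i m
    using that by (metis Suc_le_D Suc_le_mono)
  then have "(\<lambda>m. fps_cf m x) \<longlonglongrightarrow> f"
    by (intro tendsto_fpsI) (auto simp: eventually_sequentially)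
  from tendsto_fps_to_fls[OF this] have "(\<lambda>m. q_cf fls_X (cf_trunc m x)) \<longlonglongrightarrow> fps_to_fls f"
    using assms by (simp add: q_cf_trunc_eq_fps_cf)
  then have "q_real x = fps_to_fls f" unfolding q_real_def by (rule limI)
  moreover have "\<exists>n. f $ i = fps_cf (Suc (Suc n)) x $ i" for i by (auto simp: f_def)
  ultimately show ?thesis by (rule that)
qed

section \<open>Leading coefficients\<close>

text \<open>In terms of \<open>y = 1 / frac x\<close>, the upper bound on \<open>x\<close> says
  \<open>n < y\<close> and the condition in the conclusion says \<open>y \<le> n + 1\<close>. The
  index starts at 2 because truncating at \<open>b\<close> when \<open>y\<close> is not an integer
  would lower the order of the correction by one.\<close>

lemma fps_cf_low_coeffs:
  fixes x :: real and k n :: nat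
  assumes "0 < n" "real k \<le> x" "x < real k + 1 / real n" "i \<le> k + n"
  shows "fps_cf (Suc (Suc m)) x $ i
    = (if i < k then 1 else 0) + (if real k + 1 / (real n + 1) \<le> x \<and> i = k + n then 1 else 0)"
proof -
  have "1 / real n \<le> 1" using assms(1) by simp
  then have x1: "x < real k + 1" using assms(3) by linarith
  then have fl: "\<lfloor>x\<rfloor> = int k" using assms(2) by (simp add: floor_eq_iff)
  show ?thesis
  proof (cases "x \<in> \<int>")
    case True
    then have "x = real k" using fl by (auto elim!: Ints_cases)
    moreover have "0 < 1 / (real n + 1)" by (simp add: add_pos_nonneg)
    ultimately show ?thesis using True by (simp add: fps_q_nat_nth)
  next
    case False
    define y where "y = 1 / frac x"
    define b where "b = nat \<lfloor>y\<rfloor>"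
    have "1 < y" using inverse_frac_gt_1[OF False] by (simp add: y_def)
    then have b: "\<lfloor>y\<rfloor> = int b" "0 < b" by (simp_all add: b_def)
    have by': "real b \<le> y" "y < real b + 1" using b(1) by linarith+
    have x: "x = real k + 1 / y" using fl by (simp add: y_def frac_def)
    have ny: "real n < y"
      using assms(1,3) \<open>1 < y\<close> by (simp add: x field_simps)
    have iff: "real k + 1 / (real n + 1) \<le> x \<longleftrightarrow> y \<le> real n + 1"
      using \<open>1 < y\<close> by (simp add: x field_simps)
    \<comment> \<open>For integral \<open>y = b\<close> the order is \<open>k + b - 1\<close> with
      \<open>b \<ge> n + 1\<close>; otherwise it is \<open>k + b\<close> with
      \<open>b \<ge> n\<close>. Both times it equals \<open>k + n\<close> exactly when
      \<open>y \<le> n + 1\<close>.\<close>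
    obtain e u where u: "fps_cf (Suc (Suc m)) x = fps_q_nat k + fps_X ^ e * (u :: 'a fps)"
      "u $ 0 = 1" "k + n \<le> e" "y \<le> real n + 1 \<longleftrightarrow> e = k + n"
    proof (cases "y \<in> \<int>")
      case True
      then have "y = real b" using b(1) by (auto elim!: Ints_cases)
      then show ?thesis
        using True False ny fl b
        by (intro that[of "k + b - 1" "inverse (fps_q_nat b)"])
          (auto simp: fps_cf_pair_def fps_q_nat_nth simp flip: y_def)
    next
      case ni: False
      \<comment> \<open>With the endpoint excluded, \<open>y \<le> n + 1\<close> amounts to
        \<open>b = n\<close>.\<close>
      then have "y \<noteq> real n + 1" by (metis Ints_1 Ints_add Ints_of_nat)
      moreover have "1 \<le> 1 / frac y" using inverse_frac_gt_1[OF ni] by simp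
      ultimately show ?thesis
        using ni False ny fl b by'
        by (intro that[of "k + b" "fps_cf m (1 / frac y)
              * inverse (1 + fps_X * fps_q_nat b * fps_cf m (1 / frac y))"])
          (auto simp: fps_cf_step_def fps_cf_nth_0 simp flip: y_def)
    qed
    then show ?thesis
      using assms(4) unfolding iff by (auto simp: fps_q_nat_nth fps_X_power_mult_nth)
  qed
qed

theorem theorem2p4:
  fixes x :: real and k n :: nat
  assumes "0 < n" and "real k \<le> x" and "x < real k + 1 / real n"
  shows "\<exists>\<kappa> :: nat \<Rightarrow> int. q_real x = fps_to_fls
    ((\<Sum>i<k. fps_X ^ i)
      + (if real k + 1 / (real n + 1) \<le> x then fps_X ^ (k + n) else 0)
      + Abs_fps (\<lambda>i. if k + n + 1 \<le> i then of_int (\<kappa> i) else 0))"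
proof -
  have "0 \<le> x" using assms(2) by linarith
  then obtain f where f: "q_real x = fps_to_fls f"
    and stab: "\<And>i. \<exists>m. f $ i = fps_cf (Suc (Suc m)) x $ i"
    using q_real_eq_fps by blast
  have "\<forall>i. \<exists>z. f $ i = of_int z"
    using stab fps_int_coeffs_fps_cf[where 'a = rat]
    by (metis Ints_cases fps_int_coeffs_def)
  then obtain \<kappa> where \<kappa>: "\<And>i. f $ i = of_int (\<kappa> i)" by metis
  have "f $ i = (if i < k then 1 else 0)
      + (if real k + 1 / (real n + 1) \<le> x \<and> i = k + n then 1 else 0)" if "i \<le> k + n" for i
    using stab[of i] fps_cf_low_coeffs[OF assms that, where 'a = rat] by metis
  \<comment> \<open>The guard discards \<open>\<kappa>\<close> up to index \<open>k + n\<close>,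
    where the coefficients are already known.\<close>
  then have "f = (\<Sum>i<k. fps_X ^ i)
      + (if real k + 1 / (real n + 1) \<le> x then fps_X ^ (k + n) else 0)
      + Abs_fps (\<lambda>i. if k + n + 1 \<le> i then of_int (\<kappa> i) else 0)"
    by (auto simp: fps_eq_iff \<kappa> fps_q_nat_nth simp flip: fps_q_nat_def)
  with f show ?thesis by blast
qed

end
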